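(* For any Tychonoff space $X$, $\rho(X)$ is homeomorphic to a subspace of $S(\mathrm{wB}(X))$. Moreover, if $X$ is additionally locally compact and $\sigma$-compact, then $\rho(X)$ is $\omega$-bounded.
   Context: For a Tychonoff space $X$, $\beta(X)$ is the Stone–Čech compactification and $X^*=\beta(X)\setminus X$. A point $p\in X^*$ is remote if $p$ is not in the closure (in $\beta(X)$) of any nowhere dense subset of $X$. $\rho(X)$ is the subspace of $X^*$ consisting of all remote points of $X$. $\mathrm{wB}(X)=\{(U\setminus P)\cup Q: U \text{ open in } X,\ P,Q\text{ nowhere dense in }X\}$, which is an algebra of subsets of $X$ (the smallest one containing all open and all nowhere dense sets), hence a Boolean algebra. $S(\mathrm{wB}(X))$ is the Stone space of this Boolean algebra: the set of its ultrafilters with the topology generated by the sets $\{u: A\in u\}$, $A\in\mathrm{wB}(X)$. A space is $\omega$-bounded if the closure (in the space) of each of its countable subsets is compact. *)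

theory Defs
  imports "HOL-Analysis.Analysis"
begin

section \<open>The Stone--Cech compactification\<close>

(* Extensionality makes the index set contain one function per continuous map on topspace X. *)
definition sc_index :: "'a topology \<Rightarrow> ('a \<Rightarrow> real) set" where
  "sc_index X = {f \<in> extensional (topspace X). continuous_map X (top_of_set {0..1}) f}"

definition sc_cube :: "'a topology \<Rightarrow> (('a \<Rightarrow> real) \<Rightarrow> real) topology" where
  "sc_cube X = product_topology (\<lambda>f. top_of_set {0..1}) (sc_index X)"

definition sc_embed :: "'a topology \<Rightarrow> 'a \<Rightarrow> (('a \<Rightarrow> real) \<Rightarrow> real)" where
  "sc_embed X x = (\<lambda>f\<in>sc_index X. f x)"

definition stone_cech :: "'a topology \<Rightarrow> (('a \<Rightarrow> real) \<Rightarrow> real) topology" where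
  "stone_cech X = subtopology (sc_cube X) (sc_cube X closure_of (sc_embed X ` topspace X))"

lemma sc_embed_in_cube: "sc_embed X ` topspace X \<subseteq> topspace (sc_cube X)"
proof -
  have "f x \<in> {0..1}" if "x \<in> topspace X" "f \<in> sc_index X" for x f
    using that continuous_map_image_subset_topspace[of X "top_of_set {0..1::real}" f]
    by (auto simp: sc_index_def)
  then show ?thesis
    unfolding sc_embed_def sc_cube_def topspace_product_topology
    by (intro image_subsetI restrict_PiE_iff[THEN iffD2] ballI) simp
qed

lemma sc_embed_in_closure:
  "sc_embed X ` topspace X \<subseteq> sc_cube X closure_of (sc_embed X ` topspace X)"
  using sc_embed_in_cube by (rule closure_of_subset)

lemma compact_space_stone_cech: "compact_space (stone_cech X)"
proof -
  have "compact_space (sc_cube X)"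
    unfolding sc_cube_def
    unfolding compact_space_product_topology by (simp add: compact_space_subtopology)
  then show ?thesis
    unfolding stone_cech_def
    by (intro compact_space_subtopology closedin_compact_space closedin_closure_of)
qed

lemma Hausdorff_space_stone_cech: "Hausdorff_space (stone_cech X)"
proof -
  have "Hausdorff_space (sc_cube X)"
    unfolding sc_cube_def Hausdorff_space_product_topology
    by (intro disjI2 ballI Hausdorff_space_subtopology) (rule Hausdorff_space_euclidean)
  then show ?thesis
    unfolding stone_cech_def by (rule Hausdorff_space_subtopology)
qed

lemma sc_index_eq_cfunspace:
  "sc_index X = mspace (submetric (cfunspace X euclidean_metric) {f. f \<in> topspace X \<rightarrow> {0..1}})"
proof -
  have "bounded (f ` topspace X)" if "f ` topspace X \<subseteq> {0..1}" for f :: "'a \<Rightarrow> real"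
    using that bounded_closed_interval bounded_subset by blast
  then show ?thesis
    by (auto simp: sc_index_def continuous_map_in_subtopology image_subset_iff_funcset)
qed

lemma embedding_map_sc_embed:
  assumes "completely_regular_space X" "Hausdorff_space X"
  shows "embedding_map X (stone_cech X) (sc_embed X)"
proof -
  have "embedding_map X (sc_cube X) (\<lambda>x. sc_embed X x)"
    using completely_regular_space_cube_embedding_explicit [OF assms]
    unfolding sc_cube_def sc_embed_def sc_index_eq_cfunspace .
  then show ?thesis
    using sc_embed_in_closure[of X]
    by (simp add: stone_cech_def embedding_map_def subtopology_subtopology inf.absorb2)
qed

lemma dense_sc_embed: "stone_cech X closure_of (sc_embed X ` topspace X) = topspace (stone_cech X)"
proof -
  have "sc_cube X closure_of (sc_embed X ` topspace X) \<subseteq> topspace (sc_cube X)"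
    by (rule closure_of_subset_topspace)
  then show ?thesis
    using sc_embed_in_closure[of X]
    by (simp add: stone_cech_def closure_of_subtopology Int_absorb1 Int_absorb2)
qed

lemma stone_cech_extension:
  assumes "continuous_map X (top_of_set {0..1::real}) f"
  shows "\<exists>g. continuous_map (stone_cech X) (top_of_set {0..1}) g \<and>
             (\<forall>x\<in>topspace X. g (sc_embed X x) = f x)"
proof -
  let ?f = "restrict f (topspace X)"
  have f: "?f \<in> sc_index X"
    using assms by (simp add: sc_index_def continuous_map_eq)
  have "continuous_map (sc_cube X) (top_of_set {0..1}) (\<lambda>z. z ?f)"
    unfolding sc_cube_def using f by (rule continuous_map_product_projection)
  then have "continuous_map (stone_cech X) (top_of_set {0..1}) (\<lambda>z. z ?f)"
    unfolding stone_cech_def by (rule continuous_map_from_subtopology)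
  then show ?thesis
    using f by (intro exI[of _ "\<lambda>z. z ?f"]) (auto simp: sc_embed_def)
qed


section \<open>Remote points\<close>

definition nowhere_dense_in :: "'a topology \<Rightarrow> 'a set \<Rightarrow> bool" where
  "nowhere_dense_in X D \<longleftrightarrow> D \<subseteq> topspace X \<and> X interior_of (X closure_of D) = {}"

definition sc_remainder :: "'a topology \<Rightarrow> (('a \<Rightarrow> real) \<Rightarrow> real) set" where
  "sc_remainder X = topspace (stone_cech X) - sc_embed X ` topspace X"

definition remote_point :: "'a topology \<Rightarrow> (('a \<Rightarrow> real) \<Rightarrow> real) \<Rightarrow> bool" where
  "remote_point X p \<longleftrightarrow> p \<in> sc_remainder X \<and>
     (\<forall>D. nowhere_dense_in X D \<longrightarrow> p \<notin> stone_cech X closure_of (sc_embed X ` D))"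

definition remote_space :: "'a topology \<Rightarrow> (('a \<Rightarrow> real) \<Rightarrow> real) topology" where
  "remote_space X = subtopology (stone_cech X) {p. remote_point X p}"


section \<open>The algebra wB and Stone spaces\<close>

definition wB :: "'a topology \<Rightarrow> 'a set set" where
  "wB X = {(U - P) \<union> Q |U P Q. openin X U \<and> nowhere_dense_in X P \<and> nowhere_dense_in X Q}"

(* Ultrafilters of a Boolean algebra B of subsets of a set S. *)
definition ultrafilter_on :: "'a set \<Rightarrow> 'a set set \<Rightarrow> 'a set set \<Rightarrow> bool" where
  "ultrafilter_on S B u \<longleftrightarrow>
     u \<subseteq> B \<and> S \<in> u \<and> {} \<notin> u \<and>
     (\<forall>A\<in>u. \<forall>C\<in>u. A \<inter> C \<in> u) \<and>
     (\<forall>A\<in>u. \<forall>C\<in>B. A \<subseteq> C \<longrightarrow> C \<in> u) \<and>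
     (\<forall>A\<in>B. A \<in> u \<or> S - A \<in> u)"

definition stone_space :: "'a set \<Rightarrow> 'a set set \<Rightarrow> 'a set set topology" where
  "stone_space S B = topology_generated_by ((\<lambda>A. {u. ultrafilter_on S B u \<and> A \<in> u}) ` B)"

lemma topspace_stone_space: "topspace (stone_space S B) = {u. ultrafilter_on S B u}"
  by (auto simp: stone_space_def topology_generated_by_topspace ultrafilter_on_def)

lemma nowhere_dense_in_empty: "nowhere_dense_in X {}"
  by (simp add: nowhere_dense_in_def)

lemma nowhere_dense_in_subset: "nowhere_dense_in X D \<Longrightarrow> C \<subseteq> D \<Longrightarrow> nowhere_dense_in X C"
  unfolding nowhere_dense_in_def
  using interior_of_mono[OF closure_of_mono[of C D X], of X] by blast

lemma nowhere_dense_in_Un: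
  assumes "nowhere_dense_in X C" "nowhere_dense_in X D"
  shows "nowhere_dense_in X (C \<union> D)"
  using assms
  by (simp add: nowhere_dense_in_def interior_of_union_eq_empty)

lemma nowhere_dense_in_frontier:
  assumes "openin X U"
  shows "nowhere_dense_in X (X closure_of U - U)"
proof -
  have cl: "closedin X (X closure_of U - U)"
    using assms by (simp add: closedin_diff)
  have "V = {}" if V: "openin X V" "V \<subseteq> X closure_of U - U" for V
    using openin_Int_closure_of_eq_empty[OF V(1), of U] V(2) by auto
  then have "X interior_of (X closure_of U - U) = {}"
    by (metis interior_of_subset openin_interior_of)
  then show ?thesis
    using cl by (simp add: nowhere_dense_in_def closure_of_closedin closedin_subset)
qed

lemma openin_in_wB: "openin X U \<Longrightarrow> U \<in> wB X"
  unfolding wB_def mem_Collect_eq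
  by (rule exI[of _ U], rule exI[of _ "{}"], rule exI[of _ "{}"]) (simp add: nowhere_dense_in_empty)

lemma nowhere_dense_in_wB: "nowhere_dense_in X D \<Longrightarrow> D \<in> wB X"
  unfolding wB_def mem_Collect_eq
  by (rule exI[of _ "{}"], rule exI[of _ "{}"], rule exI[of _ D]) (simp add: nowhere_dense_in_empty)

lemma wB_subset_topspace: "A \<in> wB X \<Longrightarrow> A \<subseteq> topspace X"
  by (auto simp: wB_def nowhere_dense_in_def dest: openin_subset)

lemma wB_Int:
  assumes "A \<in> wB X" "B \<in> wB X"
  shows "A \<inter> B \<in> wB X"
proof -
  obtain U P Q where A: "A = (U - P) \<union> Q" "openin X U" "nowhere_dense_in X P" "nowhere_dense_in X Q"
    using assms(1) by (auto simp: wB_def)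
  obtain V R T where B: "B = (V - R) \<union> T" "openin X V" "nowhere_dense_in X R" "nowhere_dense_in X T"
    using assms(2) by (auto simp: wB_def)
  have "A \<inter> B = (U \<inter> V - (P \<union> R)) \<union> (Q \<union> T) \<inter> (A \<inter> B)"
    by (auto simp: A(1) B(1))
  moreover have "nowhere_dense_in X (P \<union> R)" "nowhere_dense_in X ((Q \<union> T) \<inter> (A \<inter> B))"
    by (rule nowhere_dense_in_Un[OF A(3) B(3)])
       (rule nowhere_dense_in_subset[OF nowhere_dense_in_Un[OF A(4) B(4)] inf_le1])
  moreover have "openin X (U \<inter> V)"
    using A(2) B(2) by (rule openin_Int)
  ultimately show ?thesis
    unfolding wB_def by blast
qed

lemma wB_compl:
  assumes "A \<in> wB X"
  shows "topspace X - A \<in> wB X"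
proof -
  obtain U P Q where A: "A = (U - P) \<union> Q" "openin X U" "nowhere_dense_in X P" "nowhere_dense_in X Q"
    using assms by (auto simp: wB_def)
  let ?T = "(P \<union> (X closure_of U - U)) \<inter> (topspace X - A)"
  have "topspace X - A = (topspace X - X closure_of U - Q) \<union> ?T"
    using openin_subset[OF A(2)] closure_of_subset[OF openin_subset[OF A(2)]] 
    by (auto simp: A(1))
  moreover have "nowhere_dense_in X ?T"
    by (rule nowhere_dense_in_subset
          [OF nowhere_dense_in_Un[OF A(3) nowhere_dense_in_frontier[OF A(2)]] inf_le1])
  moreover have "openin X (topspace X - X closure_of U)"
    by (intro openin_diff openin_topspace closedin_closure_of)
  ultimately show ?thesis
    using A(4) unfolding wB_def by blast
qed


section \<open>Compactness notions\<close>

definition sigma_compact_space :: "'a topology \<Rightarrow> bool" where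
  "sigma_compact_space X \<longleftrightarrow>
     (\<exists>\<K>. countable \<K> \<and> (\<forall>K\<in>\<K>. compactin X K) \<and> \<Union>\<K> = topspace X)"

definition omega_bounded_space :: "'a topology \<Rightarrow> bool" where
  "omega_bounded_space X \<longleftrightarrow>
     (\<forall>C. C \<subseteq> topspace X \<and> countable C \<longrightarrow> compactin X (X closure_of C))"

end

(* A remote point p misses the closure of the frontier of every open U of X. By complete
   regularity and the extension property, p therefore lies in the closure of exactly one of U and
   X - U, and the same holds for every member of wB X, which differs from an open set by a nowhere
   dense one. So the sets A in wB X with p in the closure of A form an ultrafilter, and p
   is recovered from it because traces of neighbourhoods of p belong to wB X.

   For the second part, let p 0, p 1, ... be remote points and D nowhere dense, and cover X by
   interiors of compact sets L n. There are f n with f n (p n) = 1 and f n = 0 on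
   D, L 0, ..., L n. The truncated sum of the f n is locally finite on X, so it extends to the
   compactification, where it separates the closure of the p n from the closure of D. *)
theory Submission
  imports Defs
begin

section \<open>Separation and embedding facts for the Stone-Cech compactification\<close>

lemma closedin_continuous_map_le:
  fixes f g :: "'a \<Rightarrow> real"
  assumes "continuous_map X euclideanreal f" "continuous_map X euclideanreal g"
  shows "closedin X {x \<in> topspace X. f x \<le> g x}"
proof -
  have "continuous_map X euclideanreal (\<lambda>x. g x - f x)"
    using assms by (intro continuous_map_diff)
  then have "closedin X {x \<in> topspace X. g x - f x \<in> {0..}}"
    by (rule closedin_continuous_map_preimage) simp
  then show ?thesis
    by simp
qed

lemma embedding_map_imp_continuous_map: "embedding_map X Y f \<Longrightarrow> continuous_map X Y f"
  unfolding embedding_map_def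
  using homeomorphic_imp_continuous_map continuous_map_in_subtopology by blast

lemma normal_space_stone_cech: "normal_space (stone_cech X)"
  by (simp add: compact_Hausdorff_or_regular_imp_normal_space compact_space_stone_cech
      Hausdorff_space_stone_cech)

lemma completely_regular_space_stone_cech: "completely_regular_space (stone_cech X)"
  by (simp add: normal_imp_completely_regular_space_A normal_space_stone_cech
      Hausdorff_imp_t1_space Hausdorff_space_stone_cech)

lemma regular_space_stone_cech: "regular_space (stone_cech X)"
  by (simp add: compact_Hausdorff_imp_regular_space compact_space_stone_cech
      Hausdorff_space_stone_cech)

lemma stone_cech_Urysohn:
  assumes "closedin (stone_cech X) S" "p \<in> topspace (stone_cech X)" "p \<notin> S"
  obtains f :: "(('a \<Rightarrow> real) \<Rightarrow> real) \<Rightarrow> real"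
  where "continuous_map (stone_cech X) (top_of_set {0..1}) f" "f p = 0" "\<And>x. x \<in> S \<Longrightarrow> f x = 1"
proof -
  have "p \<in> topspace (stone_cech X) - S"
    using assms by blast
  then obtain f :: "(('a \<Rightarrow> real) \<Rightarrow> real) \<Rightarrow> real"
    where "continuous_map (stone_cech X) (top_of_set {0..1}) f" "f p = 0" "f ` S \<subseteq> {1}"
    using completely_regular_space_stone_cech assms(1)
    unfolding completely_regular_space_def by meson
  then show thesis
    using that by blast
qed

lemma sc_embed_image_subset: "A \<subseteq> topspace X \<Longrightarrow> sc_embed X ` A \<subseteq> topspace (stone_cech X)"
  using sc_embed_in_cube[of X] sc_embed_in_closure[of X] by (auto simp: stone_cech_def)

lemma remote_point_in_topspace: "remote_point X p \<Longrightarrow> p \<in> topspace (stone_cech X)"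
  by (simp add: remote_point_def sc_remainder_def)

lemma topspace_remote_space: "topspace (remote_space X) = {p. remote_point X p}"
  using remote_point_in_topspace by (auto simp: remote_space_def)

section \<open>The ultrafilter on \<open>wB X\<close> given by a remote point\<close>

text \<open>Defined for every \<open>p\<close>, though shown to be an ultrafilter only for remote
  \<open>p\<close>.\<close>

definition trace_ultrafilter :: "'a topology \<Rightarrow> (('a \<Rightarrow> real) \<Rightarrow> real) \<Rightarrow> 'a set set" where
  "trace_ultrafilter X p = {A \<in> wB X. p \<in> stone_cech X closure_of (sc_embed X ` A)}"

context
  fixes X :: "'a topology"
  assumes creg: "completely_regular_space X" and haus: "Hausdorff_space X"
begin

lemma continuous_map_sc_embed: "continuous_map X (stone_cech X) (sc_embed X)"
  using embedding_map_sc_embed[OF creg haus] by (rule embedding_map_imp_continuous_map)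

text \<open>Were \<open>p\<close> in both closures, a function vanishing at \<open>p\<close> and
  equal to 1 on the frontier of \<open>U\<close> could be replaced by the constant 1 off
  \<open>U\<close>. The extension of the result would be 0 at \<open>p\<close> as a limit from
  \<open>U\<close> and 1 as a limit from the complement.\<close>

lemma remote_point_closure_open:
  assumes p: "remote_point X p" and U: "openin X U"
    and in_U: "p \<in> stone_cech X closure_of (sc_embed X ` U)"
  shows "p \<notin> stone_cech X closure_of (sc_embed X ` (topspace X - U))"
proof
  assume in_compl: "p \<in> stone_cech X closure_of (sc_embed X ` (topspace X - U))"
  let ?F = "X closure_of U - U"
  let ?S = "stone_cech X closure_of (sc_embed X ` ?F)"
  have "p \<notin> ?S"
    using p nowhere_dense_in_frontier[OF U] by (simp add: remote_point_def)
  then obtain f where f: "continuous_map (stone_cech X) (top_of_set {0..1::real}) f" "f p = 0"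
    and f1: "\<And>x. x \<in> ?S \<Longrightarrow> f x = 1"
    using stone_cech_Urysohn[OF closedin_closure_of remote_point_in_topspace[OF p]] by metis
  have fF: "f (sc_embed X x) = 1" if "x \<in> ?F" for x
  proof -
    have "sc_embed X ` ?F \<subseteq> ?S"
      by (intro closure_of_subset sc_embed_image_subset) (auto simp: in_closure_of)
    then show ?thesis
      using f1 that by blast
  qed
  \<comment> \<open>Both branches equal 1 on the frontier of \<open>U\<close>, so the glued function
    is continuous.\<close>
  let ?h = "\<lambda>x. if x \<in> U then f (sc_embed X x) else 1"
  have fe: "continuous_map X (top_of_set {0..1}) (\<lambda>x. f (sc_embed X x))"
    using continuous_map_compose[OF continuous_map_sc_embed f(1)] by (simp add: o_def)
  have h: "continuous_map X (top_of_set {0..1}) ?h"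
  proof (rule continuous_map_cases)
    fix x assume "x \<in> X frontier_of {x. x \<in> U}"
    then have "x \<in> ?F"
      using U by (simp add: frontier_of_def interior_of_openin)
    then show "f (sc_embed X x) = 1"
      by (rule fF)
  qed (auto intro: continuous_map_from_subtopology fe)
  obtain g where g: "continuous_map (stone_cech X) (top_of_set {0..1}) g"
    and gh: "\<And>x. x \<in> topspace X \<Longrightarrow> g (sc_embed X x) = ?h x"
    using stone_cech_extension[OF h] by metis
  have g': "continuous_map (stone_cech X) euclideanreal g"
    and f': "continuous_map (stone_cech X) euclideanreal f"
    using f(1) g by (auto simp: continuous_map_in_subtopology)
  have "g p = f p"
    by (rule forall_in_closure_of_eq[OF in_U _ g' f']) (use openin_subset[OF U] gh in auto)
  moreover have "g p = 1"
    by (rule forall_in_closure_of_eq[OF in_compl _ g']) (use gh in auto)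
  ultimately show False
    using f(2) by simp
qed

text \<open>\<open>A\<close> agrees with an open \<open>U\<close> up to nowhere dense sets, whose
  closures miss \<open>p\<close>, so the open case excludes lying in both closures; density of the
  image of \<open>X\<close> gives at least one.\<close>

lemma remote_point_closure_wB:
  assumes p: "remote_point X p" and A: "A \<in> wB X"
  shows "p \<in> stone_cech X closure_of (sc_embed X ` (topspace X - A)) \<longleftrightarrow>
         p \<notin> stone_cech X closure_of (sc_embed X ` A)"
    (is "p \<in> ?cl (topspace X - A) \<longleftrightarrow> _")
proof -
  obtain U P Q where UPQ: "A = (U - P) \<union> Q" "openin X U" "nowhere_dense_in X P" "nowhere_dense_in X Q"
    using A by (auto simp: wB_def)
  have cl_Un: "?cl (B \<union> C) = ?cl B \<union> ?cl C" for B C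
    by (simp add: image_Un)
  have mono: "?cl B \<subseteq> ?cl C" if "B \<subseteq> C" for B C
    using that by (intro closure_of_mono image_mono)
  have "p \<in> ?cl (topspace X)"
    using remote_point_in_topspace[OF p] by (simp add: dense_sc_embed)
  moreover have "topspace X = A \<union> (topspace X - A)"
    using wB_subset_topspace[OF A] by blast
  ultimately have cover: "p \<in> ?cl A \<or> p \<in> ?cl (topspace X - A)"
    using cl_Un by (metis Un_iff)
  have "p \<notin> ?cl P" "p \<notin> ?cl Q"
    using p UPQ by (auto simp: remote_point_def)
  moreover have "?cl A \<subseteq> ?cl U \<union> ?cl Q" "?cl (topspace X - A) \<subseteq> ?cl (topspace X - U) \<union> ?cl P"
    unfolding cl_Un[symmetric] by (rule mono, use UPQ in blast)+
  ultimately have "\<not> (p \<in> ?cl A \<and> p \<in> ?cl (topspace X - A))"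
    using remote_point_closure_open[OF p UPQ(2)] by blast
  with cover show ?thesis
    by blast
qed

lemma ultrafilter_on_trace_ultrafilter:
  assumes p: "remote_point X p"
  shows "ultrafilter_on (topspace X) (wB X) (trace_ultrafilter X p)"
proof -
  let ?cl = "\<lambda>A. stone_cech X closure_of (sc_embed X ` A)"
  have "A \<inter> C \<in> trace_ultrafilter X p"
    if "A \<in> trace_ultrafilter X p" "C \<in> trace_ultrafilter X p" for A C
  proof -
    have AC: "A \<in> wB X" "C \<in> wB X" "p \<in> ?cl A" "p \<in> ?cl C"
      using that by (auto simp: trace_ultrafilter_def)
    \<comment> \<open>Closure commutes with finite unions but not with intersections, hence the
      passage to complements.\<close>
    have "p \<notin> ?cl (topspace X - A) \<union> ?cl (topspace X - C)"
      using AC by (simp add: remote_point_closure_wB[OF p])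
    then have "p \<notin> ?cl (topspace X - A \<inter> C)"
      by (simp add: Diff_Int image_Un)
    then show ?thesis
      using wB_Int[OF AC(1,2)] remote_point_closure_wB[OF p wB_Int[OF AC(1,2)]]
      by (auto simp: trace_ultrafilter_def)
  qed
  moreover have "C \<in> trace_ultrafilter X p"
    if "A \<in> trace_ultrafilter X p" "C \<in> wB X" "A \<subseteq> C" for A C
    using that closure_of_mono[OF image_mono[OF that(3)], of "stone_cech X" "sc_embed X"]
    by (auto simp: trace_ultrafilter_def)
  moreover have "topspace X \<in> trace_ultrafilter X p"
    using remote_point_in_topspace[OF p]
    by (simp add: trace_ultrafilter_def openin_in_wB dense_sc_embed)
  moreover have "A \<in> trace_ultrafilter X p \<or> topspace X - A \<in> trace_ultrafilter X p"
    if "A \<in> wB X" for A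
    using that wB_compl[OF that] remote_point_closure_wB[OF p that]
    by (auto simp: trace_ultrafilter_def)
  moreover have "{} \<notin> trace_ultrafilter X p"
    by (simp add: trace_ultrafilter_def)
  moreover have "trace_ultrafilter X p \<subseteq> wB X"
    by (auto simp: trace_ultrafilter_def)
  ultimately show ?thesis
    unfolding ultrafilter_on_def by (intro conjI ballI impI) metis+
qed

section \<open>Recovering a point from its ultrafilter, and the embedding\<close>

lemma open_trace_in_trace_ultrafilter:
  assumes p: "p \<in> topspace (stone_cech X)" and W: "openin (stone_cech X) W" "p \<in> W"
  shows "{x \<in> topspace X. sc_embed X x \<in> W} \<in> trace_ultrafilter X p"
proof -
  let ?A = "{x \<in> topspace X. sc_embed X x \<in> W}"
  have "openin X ?A"
    using continuous_map_sc_embed W(1) by (rule openin_continuous_map_preimage)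
  moreover have "p \<in> W \<inter> stone_cech X closure_of (sc_embed X ` topspace X)"
    using p W by (simp add: dense_sc_embed)
  then have "p \<in> stone_cech X closure_of (W \<inter> sc_embed X ` topspace X)"
    using openin_Int_closure_of_subset[OF W(1)] by blast
  moreover have "W \<inter> sc_embed X ` topspace X = sc_embed X ` ?A"
    by blast
  ultimately show ?thesis
    by (simp add: trace_ultrafilter_def openin_in_wB)
qed

text \<open>By regularity some closed \<open>C\<close> inside \<open>W\<close> contains an open
  \<open>V\<close> around \<open>p\<close>, and the trace of \<open>V\<close> on \<open>X\<close>
  has its closure within \<open>C\<close>. This yields both injectivity and openness onto the image
  on remote points.\<close>

lemma trace_ultrafilter_nhd:
  assumes p: "p \<in> topspace (stone_cech X)" and W: "openin (stone_cech X) W" "p \<in> W"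
  obtains A where "A \<in> trace_ultrafilter X p" "\<And>q. A \<in> trace_ultrafilter X q \<Longrightarrow> q \<in> W"
proof -
  obtain V C where VC: "openin (stone_cech X) V" "closedin (stone_cech X) C" "p \<in> V" "V \<subseteq> C" "C \<subseteq> W"
    using regular_space_stone_cech W
    unfolding neighbourhood_base_of_closedin[symmetric] neighbourhood_base_of by metis
  let ?A = "{x \<in> topspace X. sc_embed X x \<in> V}"
  have "stone_cech X closure_of (sc_embed X ` ?A) \<subseteq> C"
    using VC by (intro closure_of_minimal) auto
  then have "q \<in> W" if "?A \<in> trace_ultrafilter X q" for q
    using that VC(5) by (auto simp: trace_ultrafilter_def)
  with that open_trace_in_trace_ultrafilter[OF p VC(1,3)] show thesis
    by blast
qed

lemma inj_on_trace_ultrafilter: "inj_on (trace_ultrafilter X) {p. remote_point X p}"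
proof (rule inj_onI, rule ccontr)
  fix p q
  assume pq: "p \<in> {p. remote_point X p}" "q \<in> {p. remote_point X p}"
    and eq: "trace_ultrafilter X p = trace_ultrafilter X q" and "p \<noteq> q"
  then obtain W where "openin (stone_cech X) W" "p \<in> W" "q \<notin> W"
    using Hausdorff_space_stone_cech[of X] remote_point_in_topspace[of X]
    unfolding Hausdorff_space_def disjnt_iff by (metis mem_Collect_eq)
  then show False
    using trace_ultrafilter_nhd remote_point_in_topspace pq(1) eq by (metis mem_Collect_eq)
qed

lemma embedding_map_trace_ultrafilter:
  "embedding_map (remote_space X) (stone_space (topspace X) (wB X)) (trace_ultrafilter X)"
proof -
  let ?R = "remote_space X" and ?S = "stone_space (topspace X) (wB X)" and ?u = "trace_ultrafilter X"
  let ?B = "\<lambda>A. {u. ultrafilter_on (topspace X) (wB X) u \<and> A \<in> u}"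
  have into: "?u ` topspace ?R \<subseteq> topspace ?S"
    using ultrafilter_on_trace_ultrafilter by (auto simp: topspace_stone_space topspace_remote_space)
  have "continuous_map ?R ?S ?u"
    unfolding stone_space_def
  proof (rule continuous_on_generated_topo)
    show "?u ` topspace ?R \<subseteq> \<Union> (?B ` wB X)"
      using into unfolding stone_space_def topology_generated_by_topspace .
    fix V assume "V \<in> ?B ` wB X"
    then obtain A where A: "A \<in> wB X" "V = ?B A"
      by blast
    \<comment> \<open>Having \<open>p\<close> in the closure of \<open>A\<close> is a closed
      condition; for remote \<open>p\<close> it is equivalent to avoiding the closure of the
      complement of \<open>A\<close>, which is an open one.\<close>
    let ?W = "topspace (stone_cech X) - stone_cech X closure_of (sc_embed X ` (topspace X - A))"
    have "?u -` V \<inter> topspace ?R = ?W \<inter> {p. remote_point X p}"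
      using A remote_point_closure_wB[OF _ A(1)] ultrafilter_on_trace_ultrafilter remote_point_in_topspace
      by (auto simp: topspace_remote_space trace_ultrafilter_def)
    moreover have "openin (stone_cech X) ?W"
      by (intro openin_diff openin_topspace closedin_closure_of)
    ultimately show "openin ?R (?u -` V \<inter> topspace ?R)"
      by (auto simp: remote_space_def openin_subtopology)
  qed
  then have cont: "continuous_map ?R (subtopology ?S (?u ` topspace ?R)) ?u"
    by (simp add: continuous_map_in_subtopology)
  have "open_map ?R (subtopology ?S (?u ` topspace ?R)) ?u"
    unfolding open_map_def
  proof (intro allI impI)
    fix G assume "openin ?R G"
    then obtain W where W: "openin (stone_cech X) W" "G = W \<inter> {p. remote_point X p}"
      by (auto simp: remote_space_def openin_subtopology)
    show "openin (subtopology ?S (?u ` topspace ?R)) (?u ` G)"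
      unfolding openin_subopen[where S = "?u ` G"]
    proof
      fix v assume "v \<in> ?u ` G"
      then obtain p where p: "v = ?u p" "p \<in> W" "remote_point X p"
        using W(2) by blast
      \<comment> \<open>The basic open set given by \<open>A\<close>, cut down to the image, is a
        neighbourhood of \<open>v\<close> inside the image of \<open>G\<close>.\<close>
      obtain A where A: "A \<in> ?u p" "\<And>q. A \<in> ?u q \<Longrightarrow> q \<in> W"
        using trace_ultrafilter_nhd[OF remote_point_in_topspace[OF p(3)] W(1) p(2)] by blast
      have "openin ?S (?B A)"
        unfolding stone_space_def
        using A(1) by (intro topology_generated_by_Basis) (auto simp: trace_ultrafilter_def)
      then have "openin (subtopology ?S (?u ` topspace ?R)) (?B A \<inter> ?u ` topspace ?R)"
        by (auto simp: openin_subtopology)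
      moreover have "v \<in> ?B A \<inter> ?u ` topspace ?R"
        using p A(1) ultrafilter_on_trace_ultrafilter by (auto simp: topspace_remote_space)
      moreover have "?B A \<inter> ?u ` topspace ?R \<subseteq> ?u ` G"
        using A(2) W(2) by (auto simp: topspace_remote_space)
      ultimately show "\<exists>T. openin (subtopology ?S (?u ` topspace ?R)) T \<and> v \<in> T \<and> T \<subseteq> ?u ` G"
        by blast
    qed
  qed
  moreover have "inj_on ?u (topspace ?R)"
    using inj_on_trace_ultrafilter by (simp add: topspace_remote_space)
  ultimately show ?thesis
    unfolding embedding_map_def using cont into
    by (intro bijective_open_imp_homeomorphic_map) (auto simp: Int_absorb1)
qed

section \<open>Omega-boundedness for locally compact, sigma-compact spaces\<close>

text \<open>A locally compact dense subspace of a Hausdorff space is open, so the image of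
  \<open>X\<close> is open in its compactification.\<close>

lemma closedin_sc_remainder:
  assumes "locally_compact_space X"
  shows "closedin (stone_cech X) (sc_remainder X)"
proof -
  have "locally_compact_space (subtopology (stone_cech X) (sc_embed X ` topspace X))"
    using embedding_map_imp_homeomorphic_space[OF embedding_map_sc_embed[OF creg haus]]
      homeomorphic_locally_compact_space assms by blast
  from locally_compact_subspace_openin_closure_of[OF Hausdorff_space_stone_cech _ this]
  have "openin (stone_cech X) (sc_embed X ` topspace X)"
    by (simp add: dense_sc_embed sc_embed_image_subset)
  then show ?thesis
    unfolding sc_remainder_def by (intro closedin_diff closedin_topspace)
qed

text \<open>Two layers serve the later construction: functions are pasted over the open
  \<open>W n\<close>, while the compact \<open>L n\<close> have closed images in
  \<open>stone_cech X\<close>.\<close>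

lemma sigma_compact_open_cover:
  assumes lc: "locally_compact_space X" and "sigma_compact_space X"
  shows "\<exists>(W :: nat \<Rightarrow> 'a set) L.
    (\<forall>n. openin X (W n) \<and> compactin X (L n) \<and> W n \<subseteq> L n) \<and> topspace X = (\<Union>n. W n)"
proof -
  obtain \<K> where \<K>: "countable \<K>" "\<And>K. K \<in> \<K> \<Longrightarrow> compactin X K" "\<Union>\<K> = topspace X"
    using assms(2) by (auto simp: sigma_compact_space_def)
  \<comment> \<open>Inserting the empty set keeps the family nonempty, so that
    \<open>from_nat_into\<close> enumerates exactly it.\<close>
  define K where "K = from_nat_into (insert {} \<K>)"
  have range_K: "range K = insert {} \<K>"
    unfolding K_def using \<K>(1) by (intro range_from_nat_into) auto
  have "compactin X (K n)" for n
    using \<K>(2) range_K by (metis compactin_empty insert_iff rangeI)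
  then have "\<exists>U L. openin X U \<and> compactin X L \<and> closedin X L \<and> K n \<subseteq> U \<and> U \<subseteq> L" for n
    using lc locally_compact_space_compact_closed_compact haus by blast
  then obtain W L where WL: "\<And>n. openin X (W n)" "\<And>n. compactin X (L n)" "\<And>n. K n \<subseteq> W n"
      "\<And>n. W n \<subseteq> L n"
    by metis
  have "topspace X = (\<Union>n. K n)"
    using range_K \<K>(3) by (metis Union_insert sup_bot_left)
  then have "topspace X \<subseteq> (\<Union>n. W n)"
    using UN_mono[of UNIV UNIV K W] WL(3) by simp
  then have "topspace X = (\<Union>n. W n)"
    by (intro equalityI UN_least openin_subset[OF WL(1)])
  then show ?thesis
    by (intro exI[of _ W] exI[of _ L] conjI allI WL(1,2,4))
qed

text \<open>With \<open>D\<close> nowhere dense, this passes remoteness from a sequence to the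
  points of its closure. The function \<open>G\<close> built below is 0 on the image of
  \<open>D\<close> and 1 at every \<open>p n\<close>, so \<open>q\<close> cannot be a limit of
  both.\<close>

lemma sequence_closure_misses_closure:
  fixes p :: "nat \<Rightarrow> ('a \<Rightarrow> real) \<Rightarrow> real"
  assumes lc: "locally_compact_space X" and sc: "sigma_compact_space X"
    and p: "\<And>n. p n \<in> sc_remainder X" and D: "D \<subseteq> topspace X"
    and pD: "\<And>n. p n \<notin> stone_cech X closure_of (sc_embed X ` D)"
    and q: "q \<in> stone_cech X closure_of (range p)"
  shows "q \<notin> stone_cech X closure_of (sc_embed X ` D)"
proof
  assume qD: "q \<in> stone_cech X closure_of (sc_embed X ` D)"
  obtain W L :: "nat \<Rightarrow> 'a set"
    where "\<forall>n. openin X (W n) \<and> compactin X (L n) \<and> W n \<subseteq> L n"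
      and W_cover: "topspace X = (\<Union>n. W n)"
    using sigma_compact_open_cover[OF lc sc] by (elim exE conjE)
  then have WL: "\<And>n. openin X (W n)" "\<And>n. compactin X (L n)" "\<And>n. W n \<subseteq> L n"
    by simp_all
  \<comment> \<open>This closed set misses \<open>p n\<close>, which lies outside the image of
    \<open>X\<close>. Including \<open>L i\<close> for all \<open>i \<le> n\<close> makes
    \<open>1 - f n\<close> vanish on \<open>W 0\<close>, ..., \<open>W n\<close>.\<close>
  define S where "S n = stone_cech X closure_of (sc_embed X ` D) \<union> (\<Union>i\<le>n. sc_embed X ` L i)" for n
  have "closedin (stone_cech X) (sc_embed X ` L i)" for i
    by (rule compactin_imp_closedin[OF Hausdorff_space_stone_cech
          image_compactin[OF WL(2) continuous_map_sc_embed]])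
  then have closed_S: "closedin (stone_cech X) (S n)" for n
    unfolding S_def by (intro closedin_Un closedin_closure_of closedin_Union) auto
  have p_top: "p n \<in> topspace (stone_cech X)" for n
    using p[of n] by (simp add: sc_remainder_def)
  have L_top: "L i \<subseteq> topspace X" for i
    by (rule compactin_subset_topspace[OF WL(2)])
  then have "p n \<notin> S n" for n
    using p[of n] pD[of n] by (auto simp: S_def sc_remainder_def)
  then have "\<exists>f. continuous_map (stone_cech X) (top_of_set {0..1::real}) f \<and> f (p n) = 0 \<and>
      (\<forall>x\<in>S n. f x = 1)" for n
    using stone_cech_Urysohn[OF closed_S p_top] by metis
  then obtain f where f: "\<And>n. continuous_map (stone_cech X) (top_of_set {0..1::real}) (f n)"
    and fp: "\<And>n. f n (p n) = 0" and fS: "\<And>n x. x \<in> S n \<Longrightarrow> f n x = 1"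
    by metis
  have f_cont: "continuous_map (stone_cech X) euclideanreal (f n)" for n
    using f by (simp add: continuous_map_in_subtopology)
  have fe_cont: "continuous_map X euclideanreal (\<lambda>x. f n (sc_embed X x))" for n
    using continuous_map_compose[OF continuous_map_sc_embed f_cont] by (simp add: o_def)
  have f_le: "f n (sc_embed X x) \<le> 1" if "x \<in> topspace X" for n x
    using f[of n] sc_embed_image_subset[of "topspace X" X] that
    by (force simp: continuous_map_in_subtopology)
  \<comment> \<open>The bumps are \<open>1 - f n\<close>, equal to 1 at \<open>p n\<close> and to 0
    on \<open>S n\<close>. Bump \<open>n\<close> vanishes on \<open>W m\<close> once
    \<open>m \<le> n\<close>, so the strict bound already gives the full sum on
    \<open>W m\<close>.\<close>
  define s where "s m x = (\<Sum>n<m. 1 - f n (sc_embed X x))" for m :: nat and x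
  \<comment> \<open>Truncation keeps the values in the unit interval, as
    \<open>stone_cech_extension\<close> requires.\<close>
  define h where "h m x = min 1 (s m x)" for m x
  have s_nonneg: "0 \<le> s m x" if "x \<in> topspace X" for m x
    unfolding s_def using f_le that by (intro sum_nonneg) simp
  have h_cont: "continuous_map X (top_of_set {0..1}) (h m)" for m
    unfolding continuous_map_in_subtopology
  proof
    show "continuous_map X euclideanreal (h m)"
      unfolding h_def s_def by (intro continuous_intros fe_cont) auto
    show "h m \<in> topspace X \<rightarrow> {0..1}"
      using s_nonneg by (auto simp: h_def)
  qed
  have vanish: "f n (sc_embed X x) = 1" if "x \<in> W m" "m \<le> n" for x m n
    using that WL(3) by (intro fS) (auto simp: S_def)
  have h_eq: "h k x = h m x" if "x \<in> W m" "m \<le> k" for k m x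
  proof -
    have "s m x = s k x"
      unfolding s_def using that vanish by (intro sum.mono_neutral_left) auto
    then show ?thesis
      by (simp add: h_def)
  qed
  have h_agree: "h i x = h j x" if "x \<in> topspace X \<inter> W i \<inter> W j" for i j x
    using that h_eq[of x i j] h_eq[of x j i] by (cases "i \<le> j") auto
  obtain g where g: "continuous_map X (top_of_set {0..1}) g"
    and gh: "\<And>x m. x \<in> topspace X \<inter> W m \<Longrightarrow> g x = h m x"
  proof (rule pasting_lemma_exists[where X = X and I = UNIV and T = W and f = h
          and Y = "top_of_set {0..1}"])
    show "topspace X \<subseteq> (\<Union>m\<in>UNIV. W m)"
      using W_cover by simp
    show "continuous_map (subtopology X (W m)) (top_of_set {0..1}) (h m)" for m
      using h_cont by (rule continuous_map_from_subtopology)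
  qed (use WL(1) h_agree that in simp_all)
  obtain G where G: "continuous_map (stone_cech X) (top_of_set {0..1}) G"
    and Gg: "\<And>x. x \<in> topspace X \<Longrightarrow> G (sc_embed X x) = g x"
    using stone_cech_extension[OF g] by metis
  have G_cont: "continuous_map (stone_cech X) euclideanreal G"
    using G by (simp add: continuous_map_in_subtopology)
  have "G q = 0"
  proof (rule forall_in_closure_of_eq[OF qD _ G_cont])
    fix y assume "y \<in> sc_embed X ` D"
    then obtain x where x: "y = sc_embed X x" "x \<in> D"
      by blast
    then obtain m where "x \<in> topspace X \<inter> W m"
      using D W_cover by blast
    moreover have "f n y = 1" for n
      using closure_of_subset[OF sc_embed_image_subset[OF D]] x by (intro fS) (auto simp: S_def)
    ultimately show "G y = 0"
      using gh Gg x by (auto simp: h_def s_def)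
  qed auto
  moreover have "G q = 1"
  proof (rule forall_in_closure_of_eq[OF q _ G_cont])
    fix y assume "y \<in> range p"
    then obtain n where y: "y = p n"
      by blast
    \<comment> \<open>At \<open>y = p n\<close> the left side is 1. The inequality is a closed
      condition, so it suffices to check it on the dense image of \<open>X\<close>.\<close>
    have "1 - f n y \<le> G y"
    proof (rule forall_in_closure_of[where P = "\<lambda>y. 1 - f n y \<le> G y"])
      show "y \<in> stone_cech X closure_of (sc_embed X ` topspace X)"
        using p_top y by (simp add: dense_sc_embed)
      show "closedin (stone_cech X) {y \<in> topspace (stone_cech X). 1 - f n y \<le> G y}"
        by (intro closedin_continuous_map_le continuous_map_diff f_cont G_cont) auto
      fix z assume "z \<in> sc_embed X ` topspace X"
      then obtain x where x: "z = sc_embed X x" "x \<in> topspace X"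
        by blast
      then obtain m where m: "x \<in> W m"
        using W_cover by blast
      \<comment> \<open>\<open>?k \<ge> m\<close> makes \<open>h ?k\<close> agree with
        \<open>h m\<close> at \<open>x\<close>, and \<open>?k > n\<close> puts bump \<open>n\<close>
        among the summands.\<close>
      let ?k = "max m (Suc n)"
      have "1 - f n z \<le> s ?k x"
        unfolding s_def x(1) using f_le x(2) by (intro member_le_sum) auto
      \<comment> \<open>This bounds the bump by 1, so that it also lies below the truncated
        sum.\<close>
      moreover have "0 \<le> f n z"
        using f[of n] x sc_embed_image_subset[of "topspace X" X]
        by (force simp: continuous_map_in_subtopology)
      ultimately have "1 - f n z \<le> h ?k x"
        by (simp add: h_def)
      also have "h ?k x = G z"
        using h_eq[OF m, of ?k] gh[of x m] Gg x m by simp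
      finally show "1 - f n z \<le> G z" .
    qed
    moreover have "G y \<le> 1"
      using G p_top[of n] y by (force simp: continuous_map_in_subtopology)
    ultimately show "G y = 1"
      using fp[of n] y by simp
  qed auto
  ultimately show False
    by simp
qed

text \<open>Limits in \<open>stone_cech X\<close> of countably many remote points are again remote,
  so the closure in \<open>remote_space X\<close> is the closure in the compactification, which is
  compact.\<close>

lemma omega_bounded_remote_space:
  assumes lc: "locally_compact_space X" and sc: "sigma_compact_space X"
  shows "omega_bounded_space (remote_space X)"
  unfolding omega_bounded_space_def
proof (intro allI impI, elim conjE)
  fix C assume C: "C \<subseteq> topspace (remote_space X)" "countable C"
  let ?cl = "stone_cech X closure_of C"
  have remote: "remote_point X q" if q: "q \<in> ?cl" for q
  proof -
    \<comment> \<open>\<open>from_nat_into\<close> enumerates exactly \<open>C\<close> only when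
      \<open>C\<close> is nonempty, which the existence of \<open>q\<close> ensures.\<close>
    have "C \<noteq> {}"
      using q by auto
    then have range_C: "range (from_nat_into C) = C"
      using C(2) by (rule range_from_nat_into)
    have p: "remote_point X (from_nat_into C n)" for n
      using C(1) range_C by (auto simp: topspace_remote_space)
    have "?cl \<subseteq> sc_remainder X"
      using C(1) closedin_sc_remainder[OF lc]
      by (intro closure_of_minimal) (auto simp: topspace_remote_space remote_point_def)
    moreover have "q \<notin> stone_cech X closure_of (sc_embed X ` D)" if "nowhere_dense_in X D" for D
      by (rule sequence_closure_misses_closure[OF lc sc, where p = "from_nat_into C"])
         (use p that q range_C in \<open>auto simp: remote_point_def nowhere_dense_in_def\<close>)
    ultimately show ?thesis
      using q by (auto simp: remote_point_def)
  qed
  have "C \<subseteq> {p. remote_point X p}"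
    using C(1) by (simp add: topspace_remote_space)
  then have "remote_space X closure_of C = ?cl"
    using remote by (auto simp: remote_space_def closure_of_subtopology Int_absorb1)
  moreover have "compactin (stone_cech X) ?cl"
    by (intro closedin_compact_space compact_space_stone_cech closedin_closure_of)
  ultimately show "compactin (remote_space X) (remote_space X closure_of C)"
    using remote by (auto simp: remote_space_def compactin_subtopology)
qed

end

theorem theorem1p8:
  fixes X :: "'a topology"
  assumes "completely_regular_space X" and "Hausdorff_space X"
  shows "(\<exists>T. T \<subseteq> topspace (stone_space (topspace X) (wB X)) \<and>
            remote_space X homeomorphic_space
              subtopology (stone_space (topspace X) (wB X)) T) \<and>
         (locally_compact_space X \<and> sigma_compact_space X \<longrightarrow>
            omega_bounded_space (remote_space X))"
proof -
  have emb: "embedding_map (remote_space X) (stone_space (topspace X) (wB X)) (trace_ultrafilter X)"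
    using assms by (rule embedding_map_trace_ultrafilter)
  \<comment> \<open>The image of the embedding is the witness \<open>T\<close>.\<close>
  have "trace_ultrafilter X ` topspace (remote_space X) \<subseteq> topspace (stone_space (topspace X) (wB X))"
    using embedding_map_imp_continuous_map[OF emb] by (rule continuous_map_image_subset_topspace)
  with embedding_map_imp_homeomorphic_space[OF emb] omega_bounded_remote_space[OF assms]
  show ?thesis
    by blast
qed

end
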